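(* Let $\mathcal{D}$ be a Ryser design of order $v$ and index $\lambda$ with replication numbers $r_1>r_2$, let $r=r_1-r_2$, let $e_1$ be the number of points with replication number $r_1$, and let $D=e_1-r_2$. (1) If $\mathcal{D}$ is of Type-1 with $D=0$, then $v=2\lambda\pm\sqrt{(2\lambda-1)^2+(r-1)^2-1}$ and $(2\lambda-1)^2+r(r-2)$ is a perfect square. (2) If $\mathcal{D}$ is of Type-1 with $D=-1$, then $v=2\lambda\pm\sqrt{(2\lambda-1)^2+(r-1)^2+4r-1}$ and $(2\lambda-1)^2+r(r+2)$ is a perfect square.
   Context: A Ryser design of order $v$ and index $\lambda$ is a pair $(X,L)$ where $X$ is a set of $v$ points and $L$ is a collection of $v$ subsets (blocks) of $X$ such that any two distinct blocks meet in exactly $\lambda$ points, every block has size $>\lambda$, and there exist two blocks of different sizes. It is known that there are integers $r_1> r_2$ with $r_1+r_2=v+1$ such that every point lies in exactly $r_1$ or exactly $r_2$ blocks (the replication numbers). A symmetric $(v,k,\mu)$ design is a set of $v$ points with $v$ blocks, each of size $k$, any two distinct blocks meeting in $\mu\ge1$ points, $k>\mu$. Given such a design with block set $\mathcal{A}$ and a fixed block $A$, the collection $\{A\}\cup\{A\triangle B: B\in\mathcal{A}, B\ne A\}$ (when $k\neq 2\mu$) is a Ryser design; a Ryser design obtained in this way is said to be of Type-1. *)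

theory Defs
  imports Complex_Main "HOL-Computational_Algebra.Nth_Powers"
begin

(* Block collections are sets of sets.  Repeated blocks are impossible in both kinds of design
   below, as two equal blocks would meet in fewer points than their own size. *)

definition ryser_design :: "'a set \<Rightarrow> 'a set set \<Rightarrow> nat \<Rightarrow> nat \<Rightarrow> bool" where
  "ryser_design X L v lam \<longleftrightarrow>
     finite X \<and> card X = v \<and> card L = v \<and> (\<forall>B\<in>L. B \<subseteq> X) \<and>
     (\<forall>B\<in>L. \<forall>C\<in>L. B \<noteq> C \<longrightarrow> card (B \<inter> C) = lam) \<and>
     (\<forall>B\<in>L. lam < card B) \<and>
     (\<exists>B\<in>L. \<exists>C\<in>L. card B \<noteq> card C)"

definition replication :: "'a set set \<Rightarrow> 'a \<Rightarrow> nat" where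
  "replication L x = card {B \<in> L. x \<in> B}"

definition replication_numbers :: "'a set \<Rightarrow> 'a set set \<Rightarrow> nat \<Rightarrow> int \<Rightarrow> int \<Rightarrow> bool" where
  "replication_numbers X L v r1 r2 \<longleftrightarrow>
     r2 < r1 \<and> r1 + r2 = int v + 1 \<and>
     (\<forall>x\<in>X. int (replication L x) = r1 \<or> int (replication L x) = r2)"

definition symmetric_design ::
    "'a set \<Rightarrow> 'a set set \<Rightarrow> nat \<Rightarrow> nat \<Rightarrow> nat \<Rightarrow> bool" where
  "symmetric_design X \<A> v k \<mu> \<longleftrightarrow>
     finite X \<and> card X = v \<and> card \<A> = v \<and> (\<forall>B\<in>\<A>. B \<subseteq> X \<and> card B = k) \<and>
     (\<forall>B\<in>\<A>. \<forall>C\<in>\<A>. B \<noteq> C \<longrightarrow> card (B \<inter> C) = \<mu>) \<and>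
     1 \<le> \<mu> \<and> \<mu> < k"

definition block_complementation :: "'a set set \<Rightarrow> 'a set \<Rightarrow> 'a set set" where
  "block_complementation \<A> A = {A} \<union> {sym_diff A B | B. B \<in> \<A> \<and> B \<noteq> A}"

definition type1 :: "'a set \<Rightarrow> 'a set set \<Rightarrow> bool" where
  "type1 X L \<longleftrightarrow>
     (\<exists>\<A> v k \<mu> A. symmetric_design X \<A> v k \<mu> \<and> k \<noteq> 2 * \<mu> \<and> A \<in> \<A> \<and>
        L = block_complementation \<A> A)"

end

(* In a block complementation of a symmetric (v, k, mu) design by A, the points of A have
   replication number v + 1 - k and the others k, and the index is k - mu; the rest is arithmetic
   from mu (v - 1) = k (k - 1).

   That a symmetric design has constant replication k usually comes from the invertibility of its
   incidence matrix.  Here it follows from the given dichotomy: each point lies in r1 or r2 blocks,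
   with r1 + r2 = v + 1, and since the sum of the replication numbers over a block is constant,
   every block contains the same number of points of each kind.  If a points have
   replication r1, double counting shows that v divides a r1 and (v - a) r2, hence
   a (r1 + r2) = a (v + 1), hence a; so a = 0 or a = v. *)

theory Submission
  imports Defs
begin

lemma sum_replication:
  assumes "finite Y" "finite L"
  shows "(\<Sum>x\<in>Y. replication L x) = (\<Sum>B\<in>L. card (Y \<inter> B))"
proof -
  have "(\<Sum>x\<in>Y. replication L x) = (\<Sum>x\<in>Y. \<Sum>B\<in>L. if x \<in> B then 1 else 0)"
    using assms by (simp add: replication_def sum.If_cases Int_def)
  also have "\<dots> = (\<Sum>B\<in>L. \<Sum>x\<in>Y. if x \<in> B then 1 else 0)"
    by (rule sum.swap)
  also have "\<dots> = (\<Sum>B\<in>L. card (Y \<inter> B))"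
    using assms by (simp add: sum.If_cases Int_def)
  finally show ?thesis .
qed

lemma symmetric_designD:
  assumes "symmetric_design X \<A> v k \<mu>"
  shows "finite X" "card X = v" "card \<A> = v" "finite \<A>" "1 \<le> \<mu>" "\<mu> < k"
    and "\<And>B. B \<in> \<A> \<Longrightarrow> B \<subseteq> X" "\<And>B. B \<in> \<A> \<Longrightarrow> card B = k"
    and "\<And>B. B \<in> \<A> \<Longrightarrow> finite B"
    and "\<And>B C. B \<in> \<A> \<Longrightarrow> C \<in> \<A> \<Longrightarrow> B \<noteq> C \<Longrightarrow> card (B \<inter> C) = \<mu>"
proof -
  have fin: "finite X" and sub: "\<And>B. B \<in> \<A> \<Longrightarrow> B \<subseteq> X"
    using assms by (auto simp: symmetric_design_def)
  show "finite X" by (rule fin)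
  show "finite \<A>" using fin sub by (meson PowI finite_Pow_iff finite_subset subsetI)
  show "finite B" if "B \<in> \<A>" for B using fin sub[OF that] by (rule rev_finite_subset)
qed (use assms in \<open>auto simp: symmetric_design_def\<close>)

text \<open>Count the pairs \<open>(x, C)\<close> with \<open>x\<close> in both \<open>B\<close> and
  \<open>C\<close>: the block \<open>C = B\<close> contributes \<open>k\<close>, each of the other
  \<open>v - 1\<close> blocks contributes \<open>\<mu>\<close>. What matters later is that the value
  does not depend on \<open>B\<close>.\<close>

lemma symmetric_design_block_sum:
  assumes sd: "symmetric_design X \<A> v k \<mu>" and B: "B \<in> \<A>"
  shows "(\<Sum>x\<in>B. int (replication \<A> x)) = int k + (int v - 1) * int \<mu>"
proof -
  note D = symmetric_designD[OF sd]
  \<comment> \<open>Lets the natural number \<open>v - 1\<close> below be read as an integer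
    difference.\<close>
  have "v > 0" using D(3,4) B by (metis card_gt_0_iff empty_iff)
  have "(\<Sum>x\<in>B. replication \<A> x) = (\<Sum>C\<in>\<A>. card (B \<inter> C))"
    by (rule sum_replication[OF D(9)[OF B] D(4)])
  also have "\<dots> = card (B \<inter> B) + (\<Sum>C\<in>\<A> - {B}. card (B \<inter> C))"
    by (rule sum.remove[OF D(4) B])
  also have "(\<Sum>C\<in>\<A> - {B}. card (B \<inter> C)) = (\<Sum>C\<in>\<A> - {B}. \<mu>)"
    by (rule sum.cong) (use D(10)[OF B] in auto)
  also have "\<dots> = (v - 1) * \<mu>"
    using D(3,4) B by simp
  finally show ?thesis using D(8)[OF B] \<open>v > 0\<close>
    by (simp flip: of_nat_sum add: of_nat_diff)
qed

lemma symmetric_design_replication_constant: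
  assumes sd: "symmetric_design X \<A> v k \<mu>"
    and r: "r1 \<noteq> r2" "r1 + r2 = int v + 1"
    and rep: "\<And>x. x \<in> X \<Longrightarrow> int (replication \<A> x) = r1 \<or> int (replication \<A> x) = r2"
    and x: "x \<in> X"
  shows "replication \<A> x = k"
proof -
  note D = symmetric_designD[OF sd]
  define Y where "Y = {x\<in>X. int (replication \<A> x) = r1}"
  define a where "a = card Y"
  have Y: "Y \<subseteq> X" "finite Y" "finite (X - Y)" using D(1) by (auto simp: Y_def)
  have aX: "int (card (X - Y)) = int v - int a"
    using Y card_mono[OF D(1) Y(1)] D(2) by (simp add: a_def card_Diff_subset of_nat_diff)
  have bk: "int (card ((X - Y) \<inter> B)) = int k - int (card (Y \<inter> B))" if "B \<in> \<A>" for B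
  proof -
    have "card B = card (Y \<inter> B) + card ((X - Y) \<inter> B)"
      using D(7,9)[OF that] by (subst card_Un_disjoint[symmetric]) (auto intro!: arg_cong[of _ _ card])
    then show ?thesis using D(8)[OF that] by simp
  qed
  \<comment> \<open>The block sum is \<open>r1 * y + r2 * (k - y)\<close> with
    \<open>y = card (Y \<inter> B)\<close>, here solved for \<open>y * (r1 - r2)\<close>. The right
    side is the same for all blocks, so \<open>r1 \<noteq> r2\<close> makes \<open>y\<close>
    constant.\<close>
  have cst: "int (card (Y \<inter> B)) * (r1 - r2) = int k + (int v - 1) * int \<mu> - int k * r2"
    if B: "B \<in> \<A>" for B
  proof -
    have fB: "finite B" using D(9)[OF B] .
    have "B = (Y \<inter> B) \<union> ((X - Y) \<inter> B)" using D(7)[OF B] by auto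
    then have "(\<Sum>x\<in>B. int (replication \<A> x))
        = (\<Sum>x\<in>(Y \<inter> B) \<union> ((X - Y) \<inter> B). int (replication \<A> x))" by simp
    also have "\<dots> = (\<Sum>x\<in>Y \<inter> B. int (replication \<A> x)) + (\<Sum>x\<in>(X - Y) \<inter> B. int (replication \<A> x))"
      by (rule sum.union_disjoint) (use fB in auto)
    also have "\<dots> = (\<Sum>x\<in>Y \<inter> B. r1) + (\<Sum>x\<in>(X - Y) \<inter> B. r2)"
      by (intro arg_cong2[of _ _ _ _ "(+)"] sum.cong) (use rep in \<open>auto simp: Y_def\<close>)
    finally show ?thesis
      using symmetric_design_block_sum[OF sd B] bk[OF B] by (simp add: algebra_simps)
  qed
  obtain B where B: "B \<in> \<A>"
    using x D(1-4) by (metis card_eq_0_iff empty_iff equals0I)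
  define b where "b = int (card (Y \<inter> B))"
  have b: "int (card (Y \<inter> C)) = b" if "C \<in> \<A>" for C
    using cst[OF that] cst[OF B] r(1) by (metis b_def mult_right_cancel right_minus_eq)
  have "int a * r1 = (\<Sum>x\<in>Y. int (replication \<A> x))"
    by (simp add: a_def Y_def)
  also have "\<dots> = (\<Sum>C\<in>\<A>. int (card (Y \<inter> C)))"
    using sum_replication[OF Y(2) D(4)] by (simp flip: of_nat_sum)
  finally have 1: "int a * r1 = int v * b" using b D(3) by simp
  have "(\<Sum>x\<in>X - Y. r2) = (\<Sum>x\<in>X - Y. int (replication \<A> x))"
    by (rule sum.cong) (use rep in \<open>auto simp: Y_def\<close>)
  also have "\<dots> = (\<Sum>C\<in>\<A>. int (card ((X - Y) \<inter> C)))"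
    using sum_replication[OF Y(3) D(4)] by (simp flip: of_nat_sum)
  finally have 2: "(int v - int a) * r2 = int v * (int k - b)" using b bk D(3) aX by simp
  \<comment> \<open>By the two double counts \<open>a * r1 = v * b\<close> and
    \<open>a * r2 = v * (r2 - k + b)\<close>, so every term is a multiple of
    \<open>v\<close>.\<close>
  have "int a = int a * (r1 + r2) - int v * int a"
    unfolding r(2) by (simp add: algebra_simps)
  also have "\<dots> = int v * (r2 + 2 * b - int k - int a)"
    using 1 2 by (simp add: algebra_simps)
  finally have "int v dvd int a" by (metis dvd_triv_left)
  then have dvd: "v dvd a" by simp
  have "a \<le> v" using D(1,2) Y(1) by (metis a_def card_mono)
  have v: "v > 0" using x D(1,2) by (metis card_gt_0_iff empty_iff)
  from dvd \<open>a \<le> v\<close> consider "a = 0" | "a = v" using dvd_imp_le by fastforce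
  then show ?thesis
  proof cases
    \<comment> \<open>Only one kind of point occurs, and the double count for that kind reads
      \<open>v * r2 = v * k\<close> here and \<open>v * r1 = v * k\<close> in the other
      case.\<close>
    case 1
    then have "Y = {}" using Y(2) by (simp add: a_def)
    then have "b = 0" by (simp add: b_def)
    moreover have "int (replication \<A> x) = r2" using \<open>Y = {}\<close> x rep by (auto simp: Y_def)
    ultimately show ?thesis using 2 v \<open>a = 0\<close> by simp
  next
    case 2
    then have "Y = X" using D(1,2) Y(1) by (metis a_def card_subset_eq)
    then have "int (replication \<A> x) = r1" using x by (auto simp: Y_def)
    moreover have "b = int k"
      using \<open>(int v - int a) * r2 = int v * (int k - b)\<close> \<open>a = v\<close> v by simp
    ultimately show ?thesis using 1 v \<open>a = v\<close> by simp
  qed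
qed

text \<open>Taking the symmetric difference with \<open>A\<close> is injective. It flips membership
  in the other blocks for points of \<open>A\<close> and keeps it for points outside; the block
  \<open>A\<close> itself stays, which accounts for the extra 1 on \<open>A\<close>.\<close>

lemma replication_block_complementation:
  assumes sd: "symmetric_design X \<A> v k \<mu>" and A: "A \<in> \<A>"
  shows "int (replication (block_complementation \<A> A) x) =
    (if x \<in> A then int v + 1 - int (replication \<A> x) else int (replication \<A> x))"
proof -
  note D = symmetric_designD[OF sd]
  have inj: "inj_on (sym_diff A) S" for S
    by (rule inj_onI) blast
  \<comment> \<open>Ensures that \<open>A\<close> is counted separately from the new blocks.\<close>
  have ne: "sym_diff A B \<noteq> A" if "B \<in> \<A>" for B
  proof
    assume "sym_diff A B = A"
    then have "B = {}" by blast
    then show False using D(6) D(8)[OF that] by simp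
  qed
  show ?thesis
  proof (cases "x \<in> A")
    case True
    \<comment> \<open>The condition \<open>B \<noteq> A\<close> needs no mention on the right, since
      \<open>A\<close> is among the removed blocks through \<open>x\<close>.\<close>
    have eq: "{C \<in> block_complementation \<A> A. x \<in> C}
        = insert A (sym_diff A ` (\<A> - {B \<in> \<A>. x \<in> B}))"
      using True A unfolding block_complementation_def by auto
    have "replication (block_complementation \<A> A) x = Suc (card (sym_diff A ` (\<A> - {B \<in> \<A>. x \<in> B})))"
      unfolding replication_def eq using D(4) ne by (intro card_insert_disjoint) auto
    also have "\<dots> = Suc (v - replication \<A> x)"
      using D(3,4) by (simp add: card_image[OF inj] card_Diff_subset replication_def)
    finally show ?thesis
      using True D(3,4) card_mono[of \<A> "{B \<in> \<A>. x \<in> B}"]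
      by (simp add: of_nat_diff replication_def)
  next
    case False
    have eq: "{C \<in> block_complementation \<A> A. x \<in> C} = sym_diff A ` {B \<in> \<A>. x \<in> B}"
      using False A unfolding block_complementation_def by auto
    show ?thesis using False unfolding replication_def eq by (simp add: card_image[OF inj])
  qed
qed

text \<open>\<open>A\<close> meets \<open>sym_diff A B\<close> in \<open>A - B\<close>, which has
  \<open>k - \<mu>\<close> points. A block other than \<open>A\<close> exists because a Ryser design
  has two block sizes.\<close>

lemma block_complementation_index:
  assumes ry: "ryser_design X (block_complementation \<A> A) v lam"
    and sd: "symmetric_design X \<A> v k \<mu>" and A: "A \<in> \<A>"
  shows "int lam = int k - int \<mu>"
proof -
  note D = symmetric_designD[OF sd]
  let ?L = "block_complementation \<A> A"
  obtain C where C: "C \<in> ?L" "C \<noteq> A"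
    using ry unfolding ryser_design_def by metis
  then obtain B where B: "B \<in> \<A>" "B \<noteq> A" "C = sym_diff A B"
    by (auto simp: block_complementation_def)
  have "A \<in> ?L" by (simp add: block_complementation_def)
  then have "lam = card (A \<inter> C)"
    using ry C unfolding ryser_design_def by metis
  also have "A \<inter> C = A - A \<inter> B" using B by blast
  also have "card \<dots> = card A - card (A \<inter> B)"
    using D(9)[OF A] by (intro card_Diff_subset) auto
  finally show ?thesis using D(6) D(8)[OF A] D(10)[OF A B(1)] B(2) by simp
qed

text \<open>The value of \<open>D\<close> tells which replication number is \<open>k\<close>: the
  points with replication \<open>r1\<close> form \<open>A\<close> if \<open>k = r2\<close>, and the
  complement of \<open>A\<close> if \<open>k = r1\<close>. The equation is the usual one for a
  symmetric design, with \<open>\<mu>\<close> replaced by \<open>k - lam\<close>.\<close>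

lemma type1_parameters:
  assumes ry: "ryser_design X L v lam"
    and rn: "replication_numbers X L v r1 r2"
    and t1: "type1 X L"
    and e1: "e1 = card {x \<in> X. int (replication L x) = r1}"
  shows "\<exists>k. (int k - int lam) * (int v - 1) = int k * (int k - 1) \<and>
    (int k = r2 \<and> int e1 - r2 = 0 \<or> int k = r1 \<and> int e1 - r2 = -1)"
proof -
  from t1 obtain \<A> v' k \<mu> A where sd': "symmetric_design X \<A> v' k \<mu>"
    and A: "A \<in> \<A>" and L: "L = block_complementation \<A> A"
    unfolding type1_def by blast
  have "v' = v" using sd' ry by (simp add: symmetric_design_def ryser_design_def)
  then have sd: "symmetric_design X \<A> v k \<mu>" using sd' by simp
  note D = symmetric_designD[OF sd]
  have r: "r2 < r1" "r1 + r2 = int v + 1"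
    and repL: "\<And>x. x \<in> X \<Longrightarrow> int (replication L x) = r1 \<or> int (replication L x) = r2"
    using rn by (auto simp: replication_numbers_def)
  note comp = replication_block_complementation[OF sd A, folded L]
  \<comment> \<open>Complementation replaces a replication number \<open>s\<close> on
    \<open>A\<close> by \<open>v + 1 - s\<close>, which only swaps \<open>r1\<close> and
    \<open>r2\<close>.\<close>
  have rep: "int (replication \<A> x) = r1 \<or> int (replication \<A> x) = r2" if "x \<in> X" for x
    using repL[OF that] comp[of x] r(2) by (auto split: if_splits)
  have const: "replication \<A> x = k" if "x \<in> X" for x
    by (rule symmetric_design_replication_constant[OF sd _ r(2) rep that]) (use r in auto)
  have "(\<Sum>x\<in>A. int (replication \<A> x)) = (\<Sum>x\<in>A. int k)"
    by (rule sum.cong) (use const D(7)[OF A] in auto)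
  then have "int k * int k = int k + (int v - 1) * int \<mu>"
    using symmetric_design_block_sum[OF sd A] D(8)[OF A] by simp
  moreover have "int k - int lam = int \<mu>"
    using block_complementation_index[OF _ sd A] ry L by simp
  ultimately have main: "(int k - int lam) * (int v - 1) = int k * (int k - 1)"
    by (simp only:) (simp add: algebra_simps)
  have compX: "int (replication L x) = (if x \<in> A then int v + 1 - int k else int k)" if "x \<in> X" for x
    using comp[of x] const[OF that] by simp
  obtain x where x: "x \<in> A" using D(6) D(8)[OF A] by (metis card.empty equals0I not_less_zero)
  have "int k = r2 \<and> int e1 - r2 = 0 \<or> int k = r1 \<and> int e1 - r2 = -1"
  proof -
    from rep[of x] const[of x] x D(7)[OF A] consider "int k = r1" | "int k = r2" by auto
    then show ?thesis
    proof cases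
      case 1
      have "{x \<in> X. int (replication L x) = r1} = X - A"
        using compX 1 r by auto
      then have "e1 = v - k"
        using e1 D(2) D(8)[OF A] D(7)[OF A] D(9)[OF A] by (simp add: card_Diff_subset)
      moreover have "k \<le> v" using D(1,2) D(7)[OF A] D(8)[OF A] by (metis card_mono)
      \<comment> \<open>\<open>e1 = v - k = v - r1 = r2 - 1\<close>.\<close>
      ultimately show ?thesis using 1 r by (simp add: of_nat_diff)
    next
      case 2
      have "{x \<in> X. int (replication L x) = r1} = A"
        using compX 2 r D(7)[OF A] by (auto split: if_splits)
      then show ?thesis using 2 e1 D(8)[OF A] by simp
    qed
  qed
  with main show ?thesis by blast
qed

lemma eq_add_or_diff_sqrt:
  fixes x y z :: real
  assumes "(x - y)\<^sup>2 = z"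
  shows "x = y + sqrt z \<or> x = y - sqrt z"
  unfolding assms[symmetric] real_sqrt_abs by linarith

theorem theorem1p11:
  fixes X :: "'a set" and L :: "'a set set"
    and v lam e1 :: nat and r1 r2 r D :: int
  assumes "ryser_design X L v lam"
    and "replication_numbers X L v r1 r2"
    and "r = r1 - r2"
    and "e1 = card {x \<in> X. int (replication L x) = r1}"
    and "D = int e1 - r2"
  shows "(type1 X L \<and> D = 0 \<longrightarrow>
            (real v = 2 * real lam
                + sqrt ((2 * real lam - 1)^2 + (real_of_int r - 1)^2 - 1) \<or>
             real v = 2 * real lam
                - sqrt ((2 * real lam - 1)^2 + (real_of_int r - 1)^2 - 1)) \<and>
            is_square ((2 * int lam - 1)^2 + r * (r - 2)))
       \<and> (type1 X L \<and> D = -1 \<longrightarrow>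
            (real v = 2 * real lam
                + sqrt ((2 * real lam - 1)^2 + (real_of_int r - 1)^2 + 4 * real_of_int r - 1) \<or>
             real v = 2 * real lam
                - sqrt ((2 * real lam - 1)^2 + (real_of_int r - 1)^2 + 4 * real_of_int r - 1)) \<and>
            is_square ((2 * int lam - 1)^2 + r * (r + 2)))"
proof (intro conjI[of "_ \<longrightarrow> _"] impI; elim conjE)
  assume t1: "type1 X L" and D0: "D = 0"
  obtain k where k: "(int k - int lam) * (int v - 1) = int k * (int k - 1)" "int k = r2"
    using type1_parameters[OF assms(1,2) t1 assms(4)] assms(5) D0 by auto
  have "r1 = int v + 1 - r2" using assms(2) by (simp add: replication_numbers_def)
  then have r: "r = int v + 1 - 2 * int k" using assms(3) k(2) by simp
  \<comment> \<open>Both sums equal \<open>(v - 2 * k)^2 - 1\<close> plus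
    \<open>(2 * lam - 1)^2\<close>, once \<open>r * (r - 2)\<close> is expanded; the parameter
    equation turns this into the left side. The radicand is the same number, as
    \<open>r * (r - 2) = (r - 1)^2 - 1\<close>.\<close>
  have sq: "(int v - 2 * int lam)\<^sup>2 = (2 * int lam - 1)^2 + r * (r - 2)"
    using k(1) unfolding r by (simp add: power2_eq_square algebra_simps)
  have "(real v - 2 * real lam)\<^sup>2 = (2 * real lam - 1)^2 + (real_of_int r - 1)^2 - 1"
    using arg_cong[OF sq, of real_of_int] by (simp add: power2_eq_square algebra_simps)
  from eq_add_or_diff_sqrt[OF this] sq
  show "(real v = 2 * real lam + sqrt ((2 * real lam - 1)^2 + (real_of_int r - 1)^2 - 1) \<or>
      real v = 2 * real lam - sqrt ((2 * real lam - 1)^2 + (real_of_int r - 1)^2 - 1)) \<and>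
      is_square ((2 * int lam - 1)^2 + r * (r - 2))"
    by (metis is_nth_power_nth_power)
next
  assume t1: "type1 X L" and D1: "D = -1"
  obtain k where k: "(int k - int lam) * (int v - 1) = int k * (int k - 1)" "int k = r1"
    using type1_parameters[OF assms(1,2) t1 assms(4)] assms(5) D1 by auto
  have "r2 = int v + 1 - r1" using assms(2) by (simp add: replication_numbers_def)
  \<comment> \<open>This is the earlier expression for \<open>r\<close> with the sign reversed, and
    \<open>r * (r + 2)\<close> is \<open>r * (r - 2)\<close> at \<open>-r\<close>; so the same
    computation applies.\<close>
  then have r: "r = 2 * int k - int v - 1" using assms(3) k(2) by simp
  have sq: "(int v - 2 * int lam)\<^sup>2 = (2 * int lam - 1)^2 + r * (r + 2)"
    using k(1) unfolding r by (simp add: power2_eq_square algebra_simps)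
  have "(real v - 2 * real lam)\<^sup>2 =
      (2 * real lam - 1)^2 + (real_of_int r - 1)^2 + 4 * real_of_int r - 1"
    using arg_cong[OF sq, of real_of_int] by (simp add: power2_eq_square algebra_simps)
  from eq_add_or_diff_sqrt[OF this] sq
  show "(real v = 2 * real lam
        + sqrt ((2 * real lam - 1)^2 + (real_of_int r - 1)^2 + 4 * real_of_int r - 1) \<or>
      real v = 2 * real lam
        - sqrt ((2 * real lam - 1)^2 + (real_of_int r - 1)^2 + 4 * real_of_int r - 1)) \<and>
      is_square ((2 * int lam - 1)^2 + r * (r + 2))"
    by (metis is_nth_power_nth_power)
qed

end
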